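(* Let $D$ be uniform and let $x\in[0,1]$ be such that $C\cap(C+x)$ is not empty. There exists a rational $t\in[0,1]$ such that $C(x)=C(t)$ if and only if $C(x)$ is a finite, disjoint union of self-similar sets.
   Context: Let $n\ge 3$ be an integer and let $D=\{d_1<d_2<\cdots<d_m\}\subseteq\{0,1,\ldots,n-1\}$ be a digit set with $2\le m<n$ and $d_1=0$. $D$ is uniform if $d_{k+1}-d_k$, $k=1,\ldots,m-1$, is constant and $\ge2$. Put $C=C_{n,D}:=\{\sum_{k=1}^\infty x_k n^{-k} : x_k\in D \text{ for all } k\ge1\}$. For $t\in\mathbb{R}$, $C+t:=\{y+t : y\in C\}$; if $C\cap(C+t)\neq\varnothing$ let $C(t):=(C\cap(C+t))-\inf(C\cap(C+t))$, otherwise $C(t):=\varnothing$. A self-similar set is a non-empty compact set $T\subset\mathbb{R}$ with $T=\bigcup_{j=1}^\ell f_j(T)$ for finitely many contracting similarities $f_j(y)=r_jy+b_j$, $0<|r_j|<1$ (singletons are allowed). *)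

theory Defs
  imports "HOL-Analysis.Analysis"
begin

definition digit_set :: "nat \<Rightarrow> nat set \<Rightarrow> bool" where
  "digit_set n D \<longleftrightarrow> D \<subseteq> {0..n - 1} \<and> 2 \<le> card D \<and> card D < n \<and> Min D = 0"

text \<open>The increasing enumeration \<open>d\<^sub>1 < \<dots> < d\<^sub>m\<close> of \<open>D\<close> is \<^term>\<open>sorted_list_of_set D\<close>, with
  indices shifted to start at \<open>0\<close>.\<close>

definition uniform_digit_set :: "nat set \<Rightarrow> bool" where
  "uniform_digit_set D \<longleftrightarrow>
     (\<exists>d\<ge>2. \<forall>k. Suc k < card D \<longrightarrow>
        sorted_list_of_set D ! Suc k = sorted_list_of_set D ! k + d)"

definition cantor_set :: "nat \<Rightarrow> nat set \<Rightarrow> real set" where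
  "cantor_set n D =
     {\<Sum>k. real (x (Suc k)) / real n ^ Suc k | x :: nat \<Rightarrow> nat. \<forall>k\<ge>1. x k \<in> D}"

definition cantor_inter :: "nat \<Rightarrow> nat set \<Rightarrow> real \<Rightarrow> real set" where
  "cantor_inter n D t = cantor_set n D \<inter> (\<lambda>y. y + t) ` cantor_set n D"

text \<open>The normalised intersection \<open>C(t)\<close>.\<close>

definition cantor_section :: "nat \<Rightarrow> nat set \<Rightarrow> real \<Rightarrow> real set" where
  "cantor_section n D t =
     (if cantor_inter n D t \<noteq> {}
      then (\<lambda>y. y - Inf (cantor_inter n D t)) ` cantor_inter n D t
      else {})"

definition self_similar_set :: "real set \<Rightarrow> bool" where
  "self_similar_set T \<longleftrightarrow> T \<noteq> {} \<and> compact T \<and>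
     (\<exists>(l::nat) (r :: nat \<Rightarrow> real) (b :: nat \<Rightarrow> real).
        (\<forall>j\<in>{1..l}. 0 < \<bar>r j\<bar> \<and> \<bar>r j\<bar> < 1) \<and>
        T = (\<Union>j\<in>{1..l}. (\<lambda>y. r j * y + b j) ` T))"

definition finite_disjoint_union_self_similar :: "real set \<Rightarrow> bool" where
  "finite_disjoint_union_self_similar A \<longleftrightarrow>
     (\<exists>F. finite F \<and> pairwise disjnt F \<and> (\<forall>T\<in>F. self_similar_set T) \<and> A = \<Union>F)"

end

theory Submission
  imports Defs
begin

text \<open>Write \<open>D = {0, d, \<dots>, M d}\<close>. After division by \<open>d\<close> the digits are \<open>0, \<dots>, M\<close> with \<open>2 M < n\<close>, and
  the admissible translations are the sums \<open>\<Sum> a\<^sub>k n\<^sup>-\<^sup>k\<close> with \<open>\<bar>a\<^sub>k\<bar> \<le> M\<close>. Such an expansion is unique unless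
  some tail of it equals \<open>\<plusminus>1/2\<close>, in which case the intersection is finite. Otherwise the normalised
  intersection consists of all sums with digits \<open>0 \<le> e\<^sub>k \<le> b\<^sub>k = M - \<bar>a\<^sub>k\<bar>\<close>, and both sides of the
  equivalence say that \<open>b\<close> is eventually periodic. For self-similar pieces this holds because
  the piece containing the minimum yields a contraction ratio \<open>\<rho>\<close> that maps a tail of the set into
  itself, and this forces \<open>b\<^sub>k \<le> b\<^bsub>k+p\<^esub>\<close>, where \<open>p\<close> is the position of the first nonzero digit
  of \<open>\<rho>\<close>.\<close>

section \<open>Shifts and eventual periodicity of integer sequences\<close>

definition shift :: "nat \<Rightarrow> (nat \<Rightarrow> int) \<Rightarrow> nat \<Rightarrow> int" where
  "shift K a k = a (k + K)"

lemma shift_0 [simp]: "shift 0 a = a"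
  by (rule ext) (simp add: shift_def)

lemma shift_shift: "shift K (shift L a) = shift (K + L) a"
  by (rule ext) (simp add: shift_def add.assoc)

text \<open>The window sums \<open>S k\<close> of \<open>p\<close> consecutive terms change by
  \<open>b (k + p) - b k\<close>, so they increase. Being bounded integers, they attain a maximum at
  some \<open>K\<close> and stay constant from there on, which turns every inequality after
  \<open>K\<close> into an equality.\<close>

lemma eventually_periodic_if_mono:
  fixes b :: "nat \<Rightarrow> int"
  assumes mono: "\<And>k. b k \<le> b (k + p)" and bounds: "\<And>k. 0 \<le> b k" "\<And>k. b k \<le> B"
  obtains K where "shift p (shift K b) = shift K b"
proof -
  define S where "S k = (\<Sum>i<p. b (k + i))" for k
  have step: "S (Suc k) + b k = S k + b (k + p)" for k
  proof -
    have "S k + b (k + p) = (\<Sum>i<Suc p. b (k + i))" by (simp add: S_def)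
    also have "\<dots> = b k + S (Suc k)" by (subst sum.lessThan_Suc_shift) (simp add: S_def)
    finally show ?thesis by simp
  qed
  have S: "0 \<le> S k" "S k \<le> int p * B" for k
    unfolding S_def using bounds sum_bounded_above[of "{..<p}" "\<lambda>i. b (k + i)" B]
    by (auto intro: sum_nonneg)
  have "\<forall>k. True \<longrightarrow> nat (S k) < nat (int p * B) + 1" using S by (auto simp: less_Suc_eq_le nat_mono)
  then obtain K where K: "\<And>k. nat (S k) \<le> nat (S K)"
    using ex_has_greatest_nat[of "\<lambda>_. True" 0 "\<lambda>k. nat (S k)"] by blast
  have "incseq S" using step mono by (intro incseq_SucI) (smt (verit))
  then have const: "S k = S K" if "k \<ge> K" for k
    using that K[of k] S(1) by (meson antisym incseqD nat_le_eq_zle order_trans)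
  have "b (k + p) = b k" if "k \<ge> K" for k
    using step[of k] const[OF that] const[of "Suc k"] that by linarith
  from this[of "k + K" for k] have "shift p (shift K b) = shift K b"
    by (intro ext) (simp add: shift_def ac_simps)
  then show ?thesis using that by blast
qed

section \<open>Self-similar sets and their finite disjoint unions\<close>

lemma self_similar_setI:
  fixes r b :: "'i \<Rightarrow> real"
  assumes "T \<noteq> {}" "compact T" "finite I" "\<And>i. i \<in> I \<Longrightarrow> 0 < \<bar>r i\<bar> \<and> \<bar>r i\<bar> < 1"
    and T: "T = (\<Union>i\<in>I. (\<lambda>y. r i * y + b i) ` T)"
  shows "self_similar_set T"
proof -
  obtain h where h: "bij_betw h {1..card I} I"
    using ex_bij_betw_nat_finite_1[OF assms(3)] by blast
  then have img: "h ` {1..card I} = I" by (simp add: bij_betw_def)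
  have "(\<Union>j\<in>{1..card I}. (\<lambda>y. r (h j) * y + b (h j)) ` T)
      = (\<Union>i\<in>h ` {1..card I}. (\<lambda>y. r i * y + b i) ` T)"
    by (simp only: image_image UN_simps)
  then have "T = (\<Union>j\<in>{1..card I}. (\<lambda>y. r (h j) * y + b (h j)) ` T)"
    unfolding img using T by (simp only:)
  moreover have "\<forall>j\<in>{1..card I}. 0 < \<bar>r (h j)\<bar> \<and> \<bar>r (h j)\<bar> < 1"
    using assms(4) img by blast
  ultimately show ?thesis
    unfolding self_similar_set_def using assms(1,2)
    by (intro conjI exI[of _ "card I"] exI[of _ "\<lambda>j. r (h j)"] exI[of _ "\<lambda>j. b (h j)"])
qed

lemma self_similar_set_affine:
  assumes "self_similar_set T" "c \<noteq> 0"
  shows "self_similar_set ((\<lambda>y. c * y + a) ` T)"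
proof -
  obtain l :: nat and r b :: "nat \<Rightarrow> real" where T: "T \<noteq> {}" "compact T"
      "\<forall>j\<in>{1..l}. 0 < \<bar>r j\<bar> \<and> \<bar>r j\<bar> < 1"
      "T = (\<Union>j\<in>{1..l}. (\<lambda>y. r j * y + b j) ` T)"
    using assms(1) unfolding self_similar_set_def by blast
  let ?g = "\<lambda>y. c * y + a"
  have "?g ` T = (\<Union>j\<in>{1..l}. ?g ` (\<lambda>y. r j * y + b j) ` T)"
    by (subst T(4)) (rule image_UN)
  \<comment> \<open>Conjugation by \<open>?g\<close> keeps the ratio \<open>r j\<close> and changes
    only the translation.\<close>
  also have "\<dots> = (\<Union>j\<in>{1..l}. (\<lambda>y. r j * y + (c * b j + a - r j * a)) ` ?g ` T)"
    unfolding image_image by (simp add: algebra_simps)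
  finally show ?thesis
    using T by (intro self_similar_setI[of _ "{1..l}" r])
      (auto intro!: compact_continuous_image continuous_intros)
qed

lemma self_similar_singleton: "self_similar_set {y}"
  \<comment> \<open>\<open>y\<close> is the fixed point of the single map
    \<open>v / 2 + y / 2\<close>.\<close>
  by (rule self_similar_setI[of _ "{()}" "\<lambda>_. 1 / 2" "\<lambda>_. y / 2"]) auto

lemma finite_disjoint_union_self_similar_affine:
  assumes "finite_disjoint_union_self_similar A" "c \<noteq> 0"
  shows "finite_disjoint_union_self_similar ((\<lambda>y. c * y + a) ` A)"
proof -
  obtain F where F: "finite F" "pairwise disjnt F" "\<forall>T\<in>F. self_similar_set T" "A = \<Union>F"
    using assms(1) unfolding finite_disjoint_union_self_similar_def by blast
  let ?g = "\<lambda>y. c * y + a"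
  have inj: "inj ?g" using assms(2) by (auto simp: inj_def)
  have "pairwise disjnt (image ?g ` F)"
    using F(2) unfolding pairwise_image
    by (auto simp: pairwise_def disjnt_def image_Int[OF inj, symmetric])
  then show ?thesis
    unfolding finite_disjoint_union_self_similar_def using F assms(2) self_similar_set_affine
    by (intro exI[of _ "image ?g ` F"]) auto
qed

lemma finite_disjoint_union_self_similar_finite:
  assumes "finite A"
  shows "finite_disjoint_union_self_similar A"
proof -
  have "pairwise disjnt ((\<lambda>y. {y}) ` A)" by (auto simp: pairwise_def disjnt_def)
  then show ?thesis
    unfolding finite_disjoint_union_self_similar_def using assms self_similar_singleton
    by (intro exI[of _ "(\<lambda>y. {y}) ` A"]) auto
qed

section \<open>Signed digit expansions in base \<open>n\<close>\<close>

locale digit_expansion =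
  fixes n M :: nat
  assumes M_pos: "1 \<le> M" and M_less: "2 * M < n"
begin

definition val :: "(nat \<Rightarrow> int) \<Rightarrow> real" where
  "val a = (\<Sum>k. of_int (a k) / real n ^ Suc k)"

text \<open>Signed, because translations arise as differences of two points with digits
  \<open>0..M\<close>.\<close>

definition digits :: "(nat \<Rightarrow> int) set" where
  "digits = {a. \<forall>k. \<bar>a k\<bar> \<le> int M}"

definition box :: "(nat \<Rightarrow> int) \<Rightarrow> (nat \<Rightarrow> int) set" where
  "box b = {e. \<forall>k. 0 \<le> e k \<and> e k \<le> b k}"

definition E :: "(nat \<Rightarrow> int) \<Rightarrow> real set" where
  "E b = val ` box b"

lemma n_ge: "n \<ge> 3" "real n > 0" "real n > 1" "2 * real M \<le> real n - 1"
  using M_pos M_less by linarith+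

lemma shift_digits [intro]: "a \<in> digits \<Longrightarrow> shift K a \<in> digits"
  by (simp add: digits_def shift_def)

lemma shift_box [intro]: "e \<in> box b \<Longrightarrow> shift K e \<in> box (shift K b)"
  by (simp add: box_def shift_def)

lemma box_digits: "b \<in> digits \<Longrightarrow> e \<in> box b \<Longrightarrow> e \<in> digits"
  unfolding digits_def box_def by (smt (verit) mem_Collect_eq)

lemma uminus_digits: "a \<in> digits \<Longrightarrow> (\<lambda>k. - a k) \<in> digits"
  by (simp add: digits_def)

lemma sums_div_power: "(\<lambda>k. c / real n ^ Suc k) sums (c / (real n - 1))"
proof -
  have "(\<lambda>k. (1 / real n) ^ k) sums (1 / (1 - 1 / real n))"
    using n_ge by (intro geometric_sums) auto
  then have "(\<lambda>k. c / real n * (1 / real n) ^ k) sums (c / real n * (1 / (1 - 1 / real n)))"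
    by (rule sums_mult)
  moreover have "c / real n * (1 / real n) ^ k = c / real n ^ Suc k" for k
    by (simp add: power_one_over)
  moreover have "c / real n * (1 / (1 - 1 / real n)) = c / (real n - 1)"
    using n_ge(2) by (simp add: right_diff_distrib)
  ultimately show ?thesis by (simp only:)
qed

lemma summable_norm_digits:
  assumes "a \<in> digits"
  shows "summable (\<lambda>k. norm (of_int (a k) / real n ^ Suc k))"
proof (rule summable_comparison_test)
  show "summable (\<lambda>k. real M / real n ^ Suc k)"
    using sums_div_power by (rule sums_summable)
  have "norm (norm (of_int (a k) / real n ^ Suc k)) \<le> real M / real n ^ Suc k" for k
  proof -
    have "\<bar>a k\<bar> \<le> int M" using assms by (simp add: digits_def)
    then have "\<bar>real_of_int (a k)\<bar> \<le> real M" by linarith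
    then have "\<bar>real_of_int (a k)\<bar> / real n ^ Suc k \<le> real M / real n ^ Suc k"
      by (rule divide_right_mono) simp
    then show ?thesis by (simp only: real_norm_def abs_divide abs_abs power_abs abs_of_nat)
  qed
  then show "\<exists>N. \<forall>k\<ge>N. norm (norm (of_int (a k) / real n ^ Suc k)) \<le> real M / real n ^ Suc k"
    by blast
qed

lemma summable_digits: "a \<in> digits \<Longrightarrow> summable (\<lambda>k. of_int (a k) / real n ^ Suc k)"
  using summable_norm_cancel[OF summable_norm_digits] .

lemma val_le:
  assumes "a \<in> digits" "b \<in> digits" "\<And>k. a k \<le> b k"
  shows "val a \<le> val b"
  unfolding val_def
  using assms n_ge by (intro suminf_le summable_digits divide_right_mono) auto

lemma val_const: "val (\<lambda>k. c) = of_int c / (real n - 1)"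
  unfolding val_def using sums_unique[OF sums_div_power] by simp

text \<open>Through this bound \<open>2 * M < n\<close> puts all values into
  \<open>[-1/2, 1/2]\<close>. Hence two remainders differ by at most 1, and nonnegative ones are
  fractional parts.\<close>

lemma half_bound: "real M / (real n - 1) \<le> 1 / 2"
  using n_ge by (simp add: field_simps)

lemma const_digits: "(\<lambda>k. int M) \<in> digits" "(\<lambda>k. 0) \<in> digits"
  by (auto simp: digits_def)

lemma val_upper: "a \<in> digits \<Longrightarrow> val a \<le> real M / (real n - 1)"
  using val_le[of a "\<lambda>k. int M"] const_digits val_const[of "int M"]
  by (force simp: digits_def abs_le_iff)

lemma val_uminus: "val (\<lambda>k. - a k) = - val a" if "a \<in> digits"
  unfolding val_def using suminf_minus[OF summable_digits[OF that]] by simp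

lemma val_abs: "a \<in> digits \<Longrightarrow> \<bar>val a\<bar> \<le> real M / (real n - 1)"
  using val_upper[of a] val_upper[OF uminus_digits, of a] val_uminus[of a] by linarith

lemma val_half: "a \<in> digits \<Longrightarrow> \<bar>val a\<bar> \<le> 1 / 2"
  using order_trans[OF val_abs half_bound] .

lemma val_add: "a \<in> digits \<Longrightarrow> b \<in> digits \<Longrightarrow> val (\<lambda>k. a k + b k) = val a + val b"
  unfolding val_def
  by (subst suminf_add[OF summable_digits summable_digits]) (auto simp: add_divide_distrib)

lemma val_diff: "a \<in> digits \<Longrightarrow> b \<in> digits \<Longrightarrow> val (\<lambda>k. a k - b k) = val a - val b"
  using val_add[of a "\<lambda>k. - b k"] uminus_digits[of b] val_uminus[of b] by simp

lemma val_0 [simp]: "val (\<lambda>k. 0) = 0"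
  by (simp add: val_def)

lemma val_nonneg: "b \<in> digits \<Longrightarrow> e \<in> box b \<Longrightarrow> 0 \<le> val e"
  using val_le[of "\<lambda>k. 0" e] const_digits box_digits[of b e] by (simp add: box_def)

lemma val_Suc:
  assumes "a \<in> digits"
  shows "val a * real n = of_int (a 0) + val (shift 1 a)"
proof -
  have "val a = of_int (a 0) / real n + (\<Sum>k. of_int (a (Suc k)) / real n ^ Suc (Suc k))"
    unfolding val_def using suminf_split_head[OF summable_digits[OF assms]] by simp
  also have "(\<Sum>k. of_int (a (Suc k)) / real n ^ Suc (Suc k))
      = (\<Sum>k. (of_int (shift 1 a k) / real n ^ Suc k) / real n)"
    by (simp add: shift_def field_simps)
  also have "\<dots> = val (shift 1 a) / real n"
    unfolding val_def using suminf_divide[OF summable_digits[OF shift_digits[OF assms]]] by blast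
  finally show ?thesis using n_ge by (simp add: field_simps)
qed

text \<open>Horner's scheme: the integer whose base \<open>n\<close> digits are the first
  \<open>K\<close> terms of \<open>a\<close>, the most significant one first.\<close>

primrec pre :: "nat \<Rightarrow> (nat \<Rightarrow> int) \<Rightarrow> int" where
  "pre 0 a = 0"
| "pre (Suc K) a = int n * pre K a + a K"

text \<open>Cutting after \<open>K\<close> digits leaves an integer and a remainder that is again a
  value. Most later arguments compare these two parts.\<close>

lemma val_pre:
  assumes "a \<in> digits"
  shows "val a * real n ^ K = of_int (pre K a) + val (shift K a)"
proof (induction K)
  case (Suc K)
  have "val a * real n ^ Suc K = (of_int (pre K a) + val (shift K a)) * real n"
    using Suc by simp
  also have "\<dots> = of_int (pre (Suc K) a) + val (shift (Suc K) a)"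
    using val_Suc[OF shift_digits[OF assms], of K]
    by (simp add: shift_shift algebra_simps) (simp add: shift_def)
  finally show ?case .
qed simp

lemma pre_nonneg: "e \<in> box b \<Longrightarrow> 0 \<le> pre K e"
  by (induction K) (auto simp: box_def)

lemma pre_cong: "(\<And>k. k < K \<Longrightarrow> a k = b k) \<Longrightarrow> pre K a = pre K b"
proof (induction K)
  case (Suc K)
  then have "pre K a = pre K b" "a K = b K" by (meson less_Suc_eq)+
  then show ?case by simp
qed simp

text \<open>At the first index where the digits differ, the integer parts differ by a nonzero
  integer, which the remainders must compensate. As these lie in \<open>[-1/2, 1/2]\<close>, their
  distance is exactly 1.\<close>

lemma val_eq_tail:
  assumes "a \<in> digits" "b \<in> digits" "val a = val b" "a \<noteq> b"
  obtains k where "\<bar>val (shift k b) - val (shift k a)\<bar> = 1"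
proof -
  obtain k where k: "a k \<noteq> b k" "\<And>i. i < k \<Longrightarrow> a i = b i"
    using assms(4) exists_least_iff[of "\<lambda>k. a k \<noteq> b k"] by (auto simp: fun_eq_iff)
  have "pre k a = pre k b" using k(2) by (rule pre_cong)
  then have "real_of_int (pre (Suc k) a) - real_of_int (pre (Suc k) b) = of_int (a k - b k)" by simp
  then have eq: "val (shift (Suc k) b) - val (shift (Suc k) a) = of_int (a k - b k)"
    using val_pre[OF assms(1), of "Suc k", unfolded assms(3)] val_pre[OF assms(2), of "Suc k"]
    by linarith
  have "\<bar>val (shift (Suc k) b) - val (shift (Suc k) a)\<bar> \<le> 1"
    using val_half[OF shift_digits[OF assms(1)], of "Suc k"]
      val_half[OF shift_digits[OF assms(2)], of "Suc k"] by linarith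
  then have "\<bar>a k - b k\<bar> \<le> 1" unfolding eq by linarith
  then have "\<bar>a k - b k\<bar> = 1" using k(1) by linarith
  then have "\<bar>val (shift (Suc k) b) - val (shift (Suc k) a)\<bar> = 1" unfolding eq
    by (metis of_int_1 of_int_abs)
  then show ?thesis using that by blast
qed

text \<open>The value \<open>1/2\<close> is extremal: in \<open>n / 2 = c 0 + remainder\<close> both
  summands must reach their upper bounds \<open>(n - 1) / 2\<close> and \<open>1/2\<close>, so the
  first digit is \<open>M\<close> and the remainder is \<open>1/2\<close> again.\<close>

lemma val_eq_half:
  assumes "a \<in> digits" "val a = 1 / 2"
  shows "a k = int M"
proof -
  have step: "c 0 = int M \<and> val (shift 1 c) = 1 / 2" if "c \<in> digits" "val c = 1 / 2" for c
  proof -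
    have "real n / 2 = of_int (c 0) + val (shift 1 c)" using val_Suc[OF that(1)] that(2) by simp
    moreover have "val (shift 1 c) \<le> 1 / 2" using val_half[OF shift_digits[OF that(1)], of 1] by linarith
    moreover have le: "c 0 \<le> int M" using that(1) by (auto simp: digits_def abs_le_iff)
    moreover have "real_of_int (c 0) \<le> real M" using le by linarith
    ultimately have "real_of_int (c 0) = real M \<and> val (shift 1 c) = 1 / 2" using n_ge(4) by linarith
    then show ?thesis by linarith
  qed
  have "val (shift k a) = 1 / 2" for k
  proof (induction k)
    case (Suc k)
    then show ?case using step[OF shift_digits[OF assms(1)], of k] by (simp add: shift_shift)
  qed (simp add: assms)
  then show ?thesis using step[OF shift_digits[OF assms(1)], of k] by (simp add: shift_def)
qed

section \<open>The sets \<open>E b\<close> and their decomposition\<close>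

lemma E_bounds: "b \<in> digits \<Longrightarrow> y \<in> E b \<Longrightarrow> 0 \<le> y \<and> y \<le> 1 / 2"
  unfolding E_def using val_nonneg val_half[OF box_digits] by (auto simp: abs_le_iff)

lemma zero_in_E: "b \<in> box (\<lambda>k. int M) \<Longrightarrow> 0 \<in> E b"
  unfolding E_def by (rule image_eqI[of _ _ "\<lambda>k. 0"]) (auto simp: box_def)

lemma box_const_digits: "b \<in> box (\<lambda>k. int M) \<Longrightarrow> b \<in> digits"
  using box_digits const_digits by blast

text \<open>The bounds at different positions are independent, so an admissible prefix may be
  continued by any admissible tail.\<close>

lemma glue:
  assumes b: "b \<in> digits" and e: "e \<in> box b" and f: "f \<in> box (shift K b)"
  shows "(val f + of_int (pre K e)) / real n ^ K \<in> E b"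
proof -
  define g where "g k = (if k < K then e k else f (k - K))" for k
  have "g \<in> box b" using e f unfolding g_def box_def shift_def
    by (auto) (metis le_add_diff_inverse2 not_le)+
  moreover have "pre K g = pre K e" by (rule pre_cong) (simp add: g_def)
  moreover have "shift K g = f" by (auto simp: g_def shift_def)
  ultimately have "val g * real n ^ K = of_int (pre K e) + val f"
    using val_pre[of g K] box_digits b by metis
  then have "(val f + of_int (pre K e)) / real n ^ K = val g" using n_ge by (simp add: field_simps)
  then show ?thesis using \<open>g \<in> box b\<close> by (simp add: E_def)
qed

text \<open>Indexing by the integer prefix instead of the digit prefix gives a finite index set, and
  distinct indices give pieces in disjoint intervals.\<close>

lemma E_decomp:
  assumes b: "b \<in> digits"
  shows "E b = (\<Union>I\<in>pre K ` box b. (\<lambda>y. (y + of_int I) / real n ^ K) ` E (shift K b))"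
proof (intro set_eqI iffI)
  fix y assume "y \<in> E b"
  then obtain e where e: "e \<in> box b" "y = val e" by (auto simp: E_def)
  have "val e = (val (shift K e) + of_int (pre K e)) / real n ^ K"
    using val_pre[OF box_digits[OF b e(1)], of K] n_ge by (simp add: field_simps)
  then show "y \<in> (\<Union>I\<in>pre K ` box b. (\<lambda>y. (y + of_int I) / real n ^ K) ` E (shift K b))"
    using e shift_box unfolding E_def by blast
next
  fix y assume "y \<in> (\<Union>I\<in>pre K ` box b. (\<lambda>y. (y + of_int I) / real n ^ K) ` E (shift K b))"
  then show "y \<in> E b" using glue[OF b] by (auto simp: E_def)
qed

lemma finite_pre:
  assumes b: "b \<in> digits"
  shows "finite (pre K ` box b)"
proof (rule finite_subset)
  show "pre K ` box b \<subseteq> {0..int (n ^ K)}"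
  proof
    fix I assume "I \<in> pre K ` box b"
    then obtain e where e: "e \<in> box b" "I = pre K e" by auto
    have "val e * real n ^ K \<le> 1 * real n ^ K"
      using val_half[OF box_digits[OF b e(1)]] by (intro mult_right_mono) auto
    moreover have "0 \<le> val (shift K e)" using val_nonneg shift_box shift_digits b e by blast
    ultimately have "real_of_int I \<le> real n ^ K"
      using val_pre[OF box_digits[OF b e(1)], of K] e by linarith
    then have "I \<le> int (n ^ K)"
      by (metis of_int_le_iff of_int_of_nat_eq of_nat_power)
    then show "I \<in> {0..int (n ^ K)}" using pre_nonneg[OF e(1)] e by simp
  qed
qed simp

text \<open>Tychonoff makes the product of the finite digit ranges compact, and \<open>val\<close>
  is continuous as a uniform limit of finite sums, by the Weierstrass test with majorant
  \<open>b i / n ^ Suc i\<close>.\<close>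

lemma compact_E:
  assumes b: "b \<in> digits"
  shows "compact (E b)"
proof -
  have "compact (PiE UNIV (\<lambda>k. {0..b k}))"
    using compactin_PiE[of "\<lambda>k. euclidean" UNIV "\<lambda>k. {0..b k}"]
    by (simp add: euclidean_product_topology finite_imp_compact)
  moreover have "PiE UNIV (\<lambda>k. {0..b k}) = box b" by (auto simp: box_def PiE_UNIV_domain)
  ultimately have "compact (box b)" by simp
  moreover have "continuous_on (box b) val"
    unfolding val_def
  proof (rule uniform_limit_theorem[OF _ Weierstrass_m_test])
    show "\<forall>\<^sub>F N in sequentially. continuous_on (box b) (\<lambda>a. \<Sum>i<N. of_int (a i) / real n ^ Suc i)"
      by (intro always_eventually allI continuous_intros continuous_on_of_int
          continuous_on_product_coordinates[THEN continuous_on_subset]) (use n_ge in auto)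
    show "norm (of_int (a i) / real n ^ Suc i) \<le> of_int (b i) / real n ^ Suc i"
      if "a \<in> box b" for a i
      using that by (auto simp: box_def abs_divide intro!: divide_right_mono)
    show "summable (\<lambda>i. of_int (b i) / real n ^ Suc i)" by (rule summable_digits[OF b])
  qed simp
  ultimately show ?thesis unfolding E_def by (intro compact_continuous_image)
qed

lemma shift_const_box: "b \<in> box (\<lambda>k. int M) \<Longrightarrow> shift K b \<in> box (\<lambda>k. int M)"
  by (simp add: box_def shift_def)

text \<open>With period \<open>p\<close> the tail after \<open>p\<close> digits ranges over the same
  set again, so the decomposition at level \<open>p\<close> is a self-similarity equation with
  common ratio \<open>1 / n ^ p\<close>.\<close>

lemma self_similar_E:
  assumes b: "b \<in> box (\<lambda>k. int M)" and p: "p \<ge> 1" "shift p b = b"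
  shows "self_similar_set (E b)"
proof (rule self_similar_setI[of _ "pre p ` box b" "\<lambda>_. 1 / real n ^ p" "\<lambda>I. of_int I / real n ^ p"])
  have "E b = (\<Union>I\<in>pre p ` box b. (\<lambda>y. (y + of_int I) / real n ^ p) ` E (shift p b))"
    by (rule E_decomp[OF box_const_digits[OF b]])
  then show "E b = (\<Union>I\<in>pre p ` box b. (\<lambda>y. 1 / real n ^ p * y + of_int I / real n ^ p) ` E b)"
    unfolding p(2) by (simp add: add_divide_distrib)
  show "0 < \<bar>1 / real n ^ p\<bar> \<and> \<bar>1 / real n ^ p\<bar> < 1"
    using n_ge(3) p(1) one_less_power[of "real n" p] by simp
qed (use b zero_in_E compact_E finite_pre box_const_digits in blast)+

text \<open>Cutting after the preperiod \<open>K\<close> leaves affine copies of one self-similar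
  set. Copy \<open>I\<close> lies in \<open>[I, I + 1/2] / n ^ K\<close>, so different copies are
  disjoint.\<close>

lemma finite_disjoint_union_self_similar_E:
  assumes b: "b \<in> box (\<lambda>k. int M)" and p: "p \<ge> 1" "shift p (shift K b) = shift K b"
  shows "finite_disjoint_union_self_similar (E b)"
proof -
  have bd: "b \<in> digits" using b by (rule box_const_digits)
  define piece where "piece I = (\<lambda>y. (y + of_int I) / real n ^ K) ` E (shift K b)" for I :: int
  have "self_similar_set ((\<lambda>y. 1 / real n ^ K * y + of_int I / real n ^ K) ` E (shift K b))" for I :: int
    using self_similar_E[OF shift_const_box[OF b] p] n_ge(2) by (intro self_similar_set_affine) auto
  then have ss: "self_similar_set (piece I)" for I
    by (simp add: piece_def add_divide_distrib)
  have "I = J" if y: "y \<in> piece I" "y \<in> piece J" for I J y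
  proof -
    obtain u where u: "u \<in> E (shift K b)" "y = (u + of_int I) / real n ^ K"
      using y(1) unfolding piece_def by auto
    obtain v where v: "v \<in> E (shift K b)" "y = (v + of_int J) / real n ^ K"
      using y(2) unfolding piece_def by auto
    have "u + of_int I = v + of_int J" using u(2) v(2) n_ge(2) by simp
    moreover have "0 \<le> u" "u \<le> 1 / 2" "0 \<le> v" "v \<le> 1 / 2"
      using E_bounds[OF shift_digits[OF bd]] u(1) v(1) by blast+
    ultimately show ?thesis by linarith
  qed
  then have "pairwise disjnt (piece ` pre K ` box b)"
    unfolding pairwise_def disjnt_iff by (metis imageE)
  moreover have "E b = \<Union> (piece ` pre K ` box b)"
    unfolding piece_def by (rule E_decomp[OF bd])
  ultimately show ?thesis
    unfolding finite_disjoint_union_self_similar_def using ss finite_pre[OF bd]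
    by (intro exI[of _ "piece ` pre K ` box b"]) auto
qed

section \<open>Rational values and uniqueness of expansions\<close>

lemma rational_val:
  assumes a: "a \<in> digits" and p: "p \<ge> 1" "shift p (shift K a) = shift K a"
  shows "val a \<in> \<rat>"
proof -
  have pos: "real n ^ p > 1" using n_ge(3) p(1) by simp
  have "val (shift K a) * real n ^ p = of_int (pre p (shift K a)) + val (shift K a)"
    using val_pre[OF shift_digits[OF a], of K p] p(2) by simp
  then have "val (shift K a) = of_int (pre p (shift K a)) / (real n ^ p - 1)"
    using pos by (simp add: field_simps)
  then have "val (shift K a) \<in> \<rat>" by simp
  moreover have "val a = (of_int (pre K a) + val (shift K a)) / real n ^ K"
    using val_pre[OF a, of K] n_ge(2) by (simp add: field_simps)
  ultimately show ?thesis by simp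
qed

text \<open>For values of expansions this means that some remainder is \<open>1/2\<close> or
  \<open>-1/2\<close>; the integer \<open>i\<close> absorbs the sign, as
  \<open>-1/2 = -1 + 1/2\<close>.\<close>

definition half_adic :: "real \<Rightarrow> bool" where
  "half_adic z \<longleftrightarrow> (\<exists>K i. z * real n ^ K = of_int i + 1 / 2)"

lemma half_adic_rational:
  assumes "half_adic z"
  shows "z \<in> \<rat>"
proof -
  obtain K :: nat and i where "z * real n ^ K = of_int i + 1 / 2"
    using assms by (auto simp: half_adic_def)
  then have "z = (of_int i + 1 / 2) / real n ^ K" using n_ge(2) by (simp add: field_simps)
  then show ?thesis by simp
qed

lemma half_adic_shift:
  assumes "a \<in> digits" "half_adic (val (shift k a))"
  shows "half_adic (val a)"
proof -
  obtain K i where K: "val (shift k a) * real n ^ K = of_int i + 1 / 2"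
    using assms(2) by (auto simp: half_adic_def)
  have "val a * real n ^ (k + K) = (of_int (pre k a) + val (shift k a)) * real n ^ K"
    using val_pre[OF assms(1), of k] by (simp add: power_add mult.assoc[symmetric])
  also have "\<dots> = of_int (pre k a * int n ^ K + i) + 1 / 2" using K by (simp add: algebra_simps)
  finally show ?thesis unfolding half_adic_def by blast
qed

text \<open>Two expansions would have remainders at distance 1 in \<open>[-1/2, 1/2]\<close>, hence
  the remainders \<open>1/2\<close> and \<open>-1/2\<close>, and either makes the value
  half-adic.\<close>

lemma val_unique:
  assumes a: "a \<in> digits" "a' \<in> digits" "val a = val a'" and "\<not> half_adic (val a)"
  shows "a = a'"
proof (rule ccontr)
  assume "a \<noteq> a'"
  then obtain k where k: "\<bar>val (shift k a') - val (shift k a)\<bar> = 1"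
    using val_eq_tail a by blast
  then have "val (shift k a) = 1 / 2 \<or> val (shift k a) = of_int (-1) + 1 / 2"
    using val_half[OF shift_digits[OF a(1)], of k] val_half[OF shift_digits[OF a(2)], of k]
    by (simp add: abs_le_iff abs_if split: if_splits)
  then have "half_adic (val (shift k a))" unfolding half_adic_def
    by (metis add_0 of_int_0 mult.right_neutral power_0)
  then show False using half_adic_shift a(1) assms(4) by blast
qed

text \<open>Long division: all remainders are multiples of \<open>1 / q\<close> in a bounded
  interval, so two of them agree. Equal remainders have equal digits by uniqueness.\<close>

lemma eventually_periodic_if_rational:
  assumes a: "a \<in> digits" and "val a \<in> \<rat>" "\<not> half_adic (val a)"
  obtains p K where "p \<ge> 1" "shift p (shift K a) = shift K a"
proof -
  obtain u q :: int where q: "q > 0" "val a = of_int u / of_int q"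
    using assms(2) by (metis Rats_cases')
  define f where "f k = u * int n ^ k - q * pre k a" for k
  have f: "of_int (f k) = of_int q * val (shift k a)" for k
    using val_pre[OF a, of k] q by (simp add: f_def field_simps)
  have "range f \<subseteq> {-q..q}"
  proof safe
    fix k
    have "\<bar>of_int q * val (shift k a)\<bar> \<le> of_int q * 1"
      unfolding abs_mult using q(1) val_half[OF shift_digits[OF a], of k]
      by (intro mult_mono) auto
    then have "\<bar>f k\<bar> \<le> q" unfolding f[symmetric] by linarith
    then show "f k \<in> {-q..q}" by auto
  qed
  then have "\<not> inj f" using finite_subset finite_imageD infinite_UNIV_nat by blast
  then obtain i j where "i < j" "f i = f j" unfolding inj_def by (metis linorder_neqE_nat)
  then have "val (shift i a) = val (shift j a)" using f[of i] f[of j] q(1) by simp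
  then have "shift i a = shift j a"
    using val_unique shift_digits[OF a] half_adic_shift[OF a] assms(3) by metis
  moreover have "shift (j - i) (shift i a) = shift j a" using \<open>i < j\<close> by (simp add: shift_shift)
  ultimately have "shift (j - i) (shift i a) = shift i a" by (simp only:)
  then show ?thesis using \<open>i < j\<close> that[of "j - i" i] by simp
qed

section \<open>Intersections of \<open>C\<close> with its translates\<close>

abbreviation C :: "real set" where
  "C \<equiv> E (\<lambda>k. int M)"

lemma C_digit:
  assumes "y \<in> C"
  obtains i y' where "i \<in> {0..int M}" "y' \<in> C" "y * real n = of_int i + y'"
proof -
  obtain e where e: "e \<in> box (\<lambda>k. int M)" "y = val e" using assms by (auto simp: E_def)
  then have "val (shift 1 e) \<in> C" "e 0 \<in> {0..int M}"
    using shift_const_box by (auto simp: E_def box_def)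
  then show ?thesis using that val_Suc[OF box_const_digits[OF e(1)]] e(2) by metis
qed

text \<open>Splitting off the first digits of both points replaces \<open>z\<close> by finitely many
  translations with a smaller exponent \<open>K\<close>. For exponent 0 a nonempty intersection
  requires \<open>z\<close> to be \<open>1/2\<close> or \<open>-1/2\<close>, and since
  \<open>C\<close> lies in \<open>[0, 1/2]\<close>, only an end point can be common.\<close>

lemma finite_inter_if_half_adic:
  assumes "half_adic z"
  shows "finite (C \<inter> (\<lambda>y. y + z) ` C)"
proof -
  obtain K i where "z * real n ^ K = of_int i + 1 / 2" using assms by (auto simp: half_adic_def)
  then show ?thesis
  proof (induction K arbitrary: z i)
    case 0
    have "C \<inter> (\<lambda>y. y + z) ` C \<subseteq> {0, 1 / 2}"
    proof
      fix v assume v: "v \<in> C \<inter> (\<lambda>y. y + z) ` C"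
      then obtain y where y: "v = y + z" "y \<in> C" "y + z \<in> C" by blast
      then have "0 \<le> y" "y \<le> 1 / 2" "0 \<le> y + z" "y + z \<le> 1 / 2"
        using E_bounds[OF const_digits(1)] by blast+
      moreover have z: "z = of_int i + 1 / 2" using 0 by simp
      ultimately have "i = 0 \<or> i = -1" by linarith
      then show "v \<in> {0, 1 / 2}"
        using z y(1) \<open>0 \<le> y\<close> \<open>y \<le> 1 / 2\<close> \<open>0 \<le> y + z\<close> \<open>y + z \<le> 1 / 2\<close> by auto
    qed
    then show ?case using finite_subset by blast
  next
    case (Suc K z m)
    \<comment> \<open>\<open>w i j\<close> is the translation between the tails of \<open>y\<close>
      and \<open>y + z\<close> when their first digits are \<open>j\<close> and
      \<open>i\<close>.\<close>
    define w where "w i j = z * real n + of_int j - of_int i" for i j :: int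
    have fin: "finite (C \<inter> (\<lambda>y. y + w i j) ` C)" for i j
    proof (rule Suc.IH)
      show "w i j * real n ^ K = of_int (m + (j - i) * int n ^ K) + 1 / 2"
        using Suc.prems by (simp add: w_def algebra_simps)
    qed
    have "C \<inter> (\<lambda>y. y + z) ` C \<subseteq>
      (\<Union>i\<in>{0..int M}. \<Union>j\<in>{0..int M}. (\<lambda>y. (of_int i + y) / real n) ` (C \<inter> (\<lambda>y. y + w i j) ` C))"
    proof safe
      fix y assume y: "y \<in> C" "y + z \<in> C"
      obtain j y' where j: "j \<in> {0..int M}" "y' \<in> C" "y * real n = of_int j + y'"
        using C_digit[OF y(1)] .
      obtain i v where i: "i \<in> {0..int M}" "v \<in> C" "(y + z) * real n = of_int i + v"
        using C_digit[OF y(2)] .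
      have "v = y' + w i j" using i(3) j(3) by (simp add: w_def algebra_simps)
      then have "v \<in> C \<inter> (\<lambda>y. y + w i j) ` C" using i(2) j(2) by blast
      moreover have "y + z = (of_int i + v) / real n" using i(3) n_ge(2) by (simp add: field_simps)
      ultimately show "y + z \<in> (\<Union>i\<in>{0..int M}. \<Union>j\<in>{0..int M}.
          (\<lambda>y. (of_int i + y) / real n) ` (C \<inter> (\<lambda>y. y + w i j) ` C))"
        using i(1) j(1) by blast
    qed
    then show ?case using finite_subset fin by (meson finite_UN_I finite_atLeastAtMost_int finite_imageI)
  qed
qed

lemma C_inter_nonempty:
  assumes "C \<inter> (\<lambda>y. y + z) ` C \<noteq> {}"
  obtains a where "a \<in> digits" "z = val a"
proof -
  obtain e f where e: "e \<in> box (\<lambda>k. int M)" "f \<in> box (\<lambda>k. int M)" "val e = val f + z"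
    using assms by (auto simp: E_def)
  have "z = val (\<lambda>k. e k - f k)" using val_diff[OF e(1,2)[THEN box_const_digits]] e(3) by simp
  moreover have "(\<lambda>k. e k - f k) \<in> digits" using e(1,2) unfolding digits_def box_def
    by (smt (verit) mem_Collect_eq)
  ultimately show ?thesis using that by blast
qed

text \<open>Uniqueness forces \<open>e k - f k = a k\<close> at each position. So \<open>e k\<close>
  starts at \<open>max 0 (a k)\<close> and has a range of length \<open>M - \<bar>a k\<bar>\<close>,
  independently for all \<open>k\<close>.\<close>

lemma C_inter_translate:
  assumes a: "a \<in> digits" and nh: "\<not> half_adic (val a)"
  shows "C \<inter> (\<lambda>y. y + val a) ` C =
    (\<lambda>y. y + val (\<lambda>k. max 0 (a k))) ` E (\<lambda>k. int M - \<bar>a k\<bar>)"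
proof (intro set_eqI iffI)
  have ak: "\<bar>a k\<bar> \<le> int M" for k using a by (simp add: digits_def)
  have mx: "(\<lambda>k. max 0 (a k)) \<in> digits" "(\<lambda>k. max 0 (- a k)) \<in> digits"
    using ak by (auto simp: digits_def) (smt (verit))+
  {
    fix y assume "y \<in> C \<inter> (\<lambda>y. y + val a) ` C"
    then obtain e f where e: "e \<in> box (\<lambda>k. int M)" "f \<in> box (\<lambda>k. int M)"
        "y = val e" "val e = val f + val a"
      by (auto simp: E_def)
    have "val a = val (\<lambda>k. e k - f k)" using val_diff[OF e(1,2)[THEN box_const_digits]] e(4) by simp
    moreover have "(\<lambda>k. e k - f k) \<in> digits" using e(1,2) unfolding digits_def box_def
      by (smt (verit) mem_Collect_eq)
    ultimately have "a = (\<lambda>k. e k - f k)" using val_unique a nh by blast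
    then have ek: "e k - f k = a k" for k by simp
    have "(\<lambda>k. e k - max 0 (a k)) \<in> box (\<lambda>k. int M - \<bar>a k\<bar>)"
      using e(1,2) unfolding box_def ek[symmetric] by (auto simp: max_def abs_if)
    moreover have "y = val (\<lambda>k. e k - max 0 (a k)) + val (\<lambda>k. max 0 (a k))"
      using val_diff[OF box_const_digits[OF e(1)] mx(1)] e(3) by simp
    ultimately show "y \<in> (\<lambda>y. y + val (\<lambda>k. max 0 (a k))) ` E (\<lambda>k. int M - \<bar>a k\<bar>)"
      unfolding E_def by blast
  next
    fix y assume "y \<in> (\<lambda>y. y + val (\<lambda>k. max 0 (a k))) ` E (\<lambda>k. int M - \<bar>a k\<bar>)"
    then obtain g where g: "g \<in> box (\<lambda>k. int M - \<bar>a k\<bar>)" "y = val g + val (\<lambda>k. max 0 (a k))"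
      by (auto simp: E_def)
    have gk: "0 \<le> g k" "g k \<le> int M - \<bar>a k\<bar>" for k using g(1) by (auto simp: box_def)
    have gd: "g \<in> digits" using gk unfolding digits_def by (smt (verit) mem_Collect_eq)
    define e f where "e k = g k + max 0 (a k)" and "f k = g k + max 0 (- a k)" for k
    have box: "e \<in> box (\<lambda>k. int M)" "f \<in> box (\<lambda>k. int M)"
      using gk unfolding e_def f_def box_def by (smt (verit) mem_Collect_eq)+
    have "val e = y" unfolding e_def using val_add[OF gd mx(1)] g(2) by simp
    moreover have "val e = val f + val a"
    proof -
      have "(\<lambda>k. e k - f k) = a" by (rule ext) (auto simp: e_def f_def)
      then show ?thesis using val_diff[OF box[THEN box_const_digits]] by simp
    qed
    ultimately show "y \<in> C \<inter> (\<lambda>y. y + val a) ` C" using box unfolding E_def by blast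
  }
qed

section \<open>From self-similar pieces to eventual periodicity\<close>

lemma unit_in_E:
  assumes b: "b \<in> box (\<lambda>k. int M)" and c: "0 \<le> c" "c \<le> b k"
  shows "of_int c / real n ^ Suc k \<in> E b"
proof -
  define e where "e i = (if i = k then c else 0)" for i
  have e: "e \<in> box b" using b c by (auto simp: e_def box_def)
  have "pre k e = pre k (\<lambda>_. 0)" by (rule pre_cong) (simp add: e_def)
  also have "\<dots> = 0" by (induction k) auto
  finally have "pre (Suc k) e = c" by (simp add: e_def)
  moreover have "shift (Suc k) e = (\<lambda>_. 0)" by (rule ext) (simp add: e_def shift_def)
  ultimately have "val e * real n ^ Suc k = of_int c"
    using val_pre[of e "Suc k"] box_digits[OF box_const_digits[OF b] e] by simp
  then have "of_int c / real n ^ Suc k = val e" using n_ge(2) by (simp add: field_simps)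
  then show ?thesis using e by (simp add: E_def)
qed

text \<open>Here \<open>y\<close> is a nonnegative integer prefix plus a nonnegative remainder.
  Being below 1, it has prefix 0 and equals the remainder.\<close>

lemma small_in_E:
  assumes b: "b \<in> digits" and "y / real n ^ N \<in> E b" "y < 1"
  shows "y \<in> E (shift N b)"
proof -
  obtain g where g: "g \<in> box b" "val g = y / real n ^ N" using assms(2) by (auto simp: E_def)
  have "y = of_int (pre N g) + val (shift N g)"
    using val_pre[OF box_digits[OF b g(1)], of N] g(2) n_ge(2) by simp
  moreover have "0 \<le> val (shift N g)" using val_nonneg shift_digits b shift_box g(1) by blast
  ultimately have "pre N g = 0" using pre_nonneg[OF g(1), of N] assms(3) by linarith
  then show ?thesis using \<open>y = _\<close> shift_box[OF g(1)] by (simp add: E_def)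
qed

text \<open>If \<open>\<rho>\<close> has its first nonzero digit at position \<open>p\<close>, then multiplying the points \<open>c n\<^sup>-\<^sup>k\<close>
  by \<open>\<rho>\<close> produces no carries, so the digit bound at \<open>k + p\<close> is at least the one at \<open>k\<close>. The
  exception is a remainder \<open>\<tau> = 1/2\<close>, which makes all later digits of \<open>\<rho>\<close> equal to \<open>M\<close>.\<close>

lemma eventually_periodic_if_contracted:
  assumes b: "b \<in> box (\<lambda>k. int M)" and \<rho>: "0 < \<rho>" "\<rho> < 1"
    and contr: "\<And>y. y \<in> E b \<Longrightarrow> \<rho> * y \<in> E b"
  obtains p K where "p \<ge> 1" "shift p (shift K b) = shift K b"
proof (cases "\<forall>k. b k = 0")
  case True
  then have "shift 1 (shift 0 b) = shift 0 b" by (auto simp: shift_def)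
  then show ?thesis using that by blast
next
  case False
  have bd: "b \<in> digits" using b by (rule box_const_digits)
  have bk: "0 \<le> b k" "b k \<le> int M" for k using b by (auto simp: box_def)
  obtain k0 where "b k0 \<noteq> 0" using False by blast
  then have k0: "1 \<le> b k0" using bk(1)[of k0] by linarith
  \<comment> \<open>Scaling the point with a single digit 1 at a position allowed by
    \<open>b\<close> exhibits \<rho> as a point of a tail set, which gives it a digit expansion
    \<open>r\<close>.\<close>
  have "\<rho> / real n ^ Suc k0 \<in> E b"
    using contr[OF unit_in_E[OF b _ k0]] by simp
  then have "\<rho> \<in> E (shift (Suc k0) b)" using small_in_E[OF bd] \<rho> by blast
  then obtain r where r: "r \<in> box (shift (Suc k0) b)" "\<rho> = val r" by (auto simp: E_def)
  have rd: "r \<in> digits" using box_digits shift_digits bd r(1) by blast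
  have rk: "0 \<le> r k" "r k \<le> b (k + Suc k0)" for k using r(1) by (auto simp: box_def shift_def)
  have "\<exists>j. r j \<noteq> 0"
  proof (rule ccontr)
    assume "\<not> ?thesis"
    then have "r = (\<lambda>_. 0)" by auto
    then show False using r(2) \<rho>(1) by simp
  qed
  then obtain j where j: "r j \<noteq> 0" "\<And>i. i < j \<Longrightarrow> r i = 0"
    using exists_least_iff[of "\<lambda>j. r j \<noteq> 0"] by auto
  have "pre j r = pre j (\<lambda>_. 0)" by (rule pre_cong) (simp add: j)
  also have "\<dots> = 0" by (induction j) auto
  finally have pre: "pre (Suc j) r = r j" by simp
  \<comment> \<open>Counting positions from 1 makes \<open>q\<close> the integer part and \<tau> the
    remainder of \<open>\<rho> * n ^ p\<close>.\<close>
  define p q \<tau> where "p = Suc j" and "q = r j" and "\<tau> = val (shift p r)"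
  have \<rho>_eq: "\<rho> * real n ^ p = of_int q + \<tau>"
    using val_pre[OF rd, of p] pre r(2) by (simp add: p_def q_def \<tau>_def)
  have q: "1 \<le> q" "q \<le> int M"
    using rk(1)[of j] j(1) order_trans[OF rk(2)[of j] bk(2)] by (auto simp: q_def)
  have \<tau>: "0 \<le> \<tau>" "\<tau> \<le> 1 / 2"
    using val_nonneg[OF shift_digits[OF shift_digits[OF bd]] shift_box[OF r(1)]]
      val_half[OF shift_digits[OF rd]] unfolding \<tau>_def by (auto simp: abs_le_iff)
  show ?thesis
  proof (cases "\<tau> = 1 / 2")
    case True
    then have "r (k + p) = int M" for k
      using val_eq_half[OF shift_digits[OF rd], of p k] by (simp add: \<tau>_def shift_def)
    then have "b (k + p + Suc k0) = int M" for k
      using rk(2)[of "k + p"] bk(2)[of "k + p + Suc k0"] by (metis antisym)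
    then have "shift (p + Suc k0) b = (\<lambda>_. int M)"
      by (intro ext) (simp add: shift_def add.assoc)
    then have "shift 1 (shift (p + Suc k0) b) = shift (p + Suc k0) b"
      by (simp only:) (simp add: shift_def fun_eq_iff)
    then show ?thesis using that by blast
  next
    case False
    \<comment> \<open>The first claim excludes carries and supports the second. From
      \<open>c * \<tau> \<le> 1/2\<close> and \<open>\<tau> < 1/2\<close> follows
      \<open>(c + 1) * \<tau> < 1\<close>; comparison with the remainder \<open>u\<close> of a point
      of \<open>E b\<close>, which is at most \<open>1/2\<close>, then sharpens this to
      \<open>(c + 1) * \<tau> \<le> 1/2\<close>.\<close>
    have key: "real c * \<tau> \<le> 1 / 2 \<and> int c * q \<le> b (k + p)" if "int c \<le> b k" for c k
      using that
    proof (induction c)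
      case (Suc c)
      then have IH: "real c * \<tau> \<le> 1 / 2" "int c * q \<le> int M"
        using order_trans[OF _ bk(2)[of "k + p"]] by auto
      define X where "X = int (Suc c) * q"
      have "\<rho> * (of_int (int (Suc c)) / real n ^ Suc k) \<in> E b"
        using Suc.prems by (intro contr unit_in_E b) auto
      then obtain s where s: "s \<in> box b" "val s = \<rho> * (real (Suc c) / real n ^ Suc k)"
        by (auto simp: E_def)
      define u where "u = val (shift (Suc (k + p)) s)"
      have u: "0 \<le> u" "u \<le> 1 / 2"
        using val_nonneg[OF shift_digits[OF bd] shift_box[OF s(1)]]
          val_half[OF shift_digits[OF box_digits[OF bd s(1)]]] unfolding u_def
        by (auto simp: abs_le_iff)
      have "val s * real n ^ Suc (k + p) = \<rho> * real n ^ p * real (Suc c)"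
        unfolding s(2) using n_ge(2) by (simp add: power_add)
      also have "\<dots> = of_int X + (real c * \<tau> + \<tau>)"
        unfolding \<rho>_eq X_def by (simp add: algebra_simps)
      finally have eq: "of_int X + (real c * \<tau> + \<tau>) = of_int (pre (Suc (k + p)) s) + u"
        using val_pre[OF box_digits[OF bd s(1)], of "Suc (k + p)"] by (simp only: u_def)
      have "real c * \<tau> + \<tau> < 1" "0 \<le> real c * \<tau> + \<tau>"
        using IH(1) \<tau> False by auto
      then have X: "X = pre (Suc (k + p)) s" using eq u by linarith
      then have "real c * \<tau> + \<tau> \<le> 1 / 2" using eq u by linarith
      moreover have "X = s (k + p)"
      proof -
        \<comment> \<open>Since \<open>X\<close> is at most \<open>2 * M < n\<close>, the integer
          prefix of \<open>s\<close> consists of its last digit alone.\<close>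
        have "X = int n * pre (k + p) s + s (k + p)" using X by simp
        moreover have "X \<le> int M + int M" using IH(2) q(2) by (simp add: X_def algebra_simps)
        moreover have "0 \<le> s (k + p)" using s(1) by (simp add: box_def)
        ultimately have "int n * pre (k + p) s < int n * 1" using M_less by linarith
        then have "pre (k + p) s < 1" using n_ge(1) by (simp add: mult_less_cancel_left)
        then have "pre (k + p) s = 0" using pre_nonneg[OF s(1), of "k + p"] by linarith
        then show ?thesis using X by simp
      qed
      moreover have "s (k + p) \<le> b (k + p)" using s(1) by (simp add: box_def)
      ultimately show ?case by (simp add: X_def algebra_simps)
    qed (simp add: bk)
    \<comment> \<open>The case \<open>c = b k\<close> of \<open>key\<close> suffices because
      \<open>q \<ge> 1\<close>.\<close>
    have "b k \<le> b (k + p)" for k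
    proof -
      have "int (nat (b k)) * q \<le> b (k + p)" using key[of "nat (b k)" k] bk(1)[of k] by simp
      moreover have "b k * 1 \<le> b k * q" using bk(1) q(1) by (intro mult_left_mono) auto
      ultimately show ?thesis using bk(1)[of k] by simp
    qed
    then obtain K where "shift p (shift K b) = shift K b"
      using eventually_periodic_if_mono[of b p "int M"] bk by blast
    then show ?thesis using that[of p K] by (simp add: p_def)
  qed
qed

text \<open>The piece \<open>T\<close> containing \<open>0\<close> is relatively open in \<open>E b\<close>, so near its minimum \<open>0\<close> and,
  reflected, near its maximum \<open>m\<close> it contains the same set \<open>E (shift N b) / n ^ N\<close>. The map
  sending a point of \<open>T\<close> to \<open>0\<close> sends \<open>0\<close> or \<open>m\<close> to \<open>0\<close>, according to its orientation.\<close>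

lemma contraction_if_finite_disjoint_union_self_similar:
  assumes b: "b \<in> box (\<lambda>k. int M)" and "finite_disjoint_union_self_similar (E b)"
  obtains N \<rho> where "0 < \<rho>" "\<rho> < 1" "\<And>y. y \<in> E (shift N b) \<Longrightarrow> \<rho> * y \<in> E (shift N b)"
proof -
  have bd: "b \<in> digits" using b by (rule box_const_digits)
  obtain F where F: "finite F" "pairwise disjnt F" "\<forall>T\<in>F. self_similar_set T" "E b = \<Union>F"
    using assms(2) unfolding finite_disjoint_union_self_similar_def by blast
  obtain T where T: "T \<in> F" "0 \<in> T" using zero_in_E[OF b] F(4) by blast
  obtain l :: nat and r c :: "nat \<Rightarrow> real" where T': "compact T"
      "\<forall>j\<in>{1..l}. 0 < \<bar>r j\<bar> \<and> \<bar>r j\<bar> < 1"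
      "T = (\<Union>j\<in>{1..l}. (\<lambda>y. r j * y + c j) ` T)"
    using bspec[OF F(3) T(1)] unfolding self_similar_set_def by blast
  have TE: "T \<subseteq> E b" using T(1) F(4) by blast
  have "compact (\<Union>(F - {T}))"
    using F(1,3) by (intro compact_Union) (auto simp: self_similar_set_def)
  moreover have "T \<inter> \<Union>(F - {T}) = {}" using F(2) T(1) by (auto simp: pairwise_def disjnt_iff)
  ultimately obtain \<epsilon> where \<epsilon>: "\<epsilon> > 0" "\<And>y w. y \<in> T \<Longrightarrow> w \<in> \<Union>(F - {T}) \<Longrightarrow> \<epsilon> \<le> dist y w"
    using separate_compact_closed[OF T'(1) compact_imp_closed] by metis
  have near: "v \<in> T" if "y \<in> T" "v \<in> E b" "\<bar>y - v\<bar> < \<epsilon>" for y v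
    using that \<epsilon>(2)[of y v] F(4) by (fastforce simp: dist_real_def)
  \<comment> \<open>Cylinders of level \<open>N\<close> are shorter than the gap \<epsilon>, so a
    cylinder that meets \<open>T\<close> lies in \<open>T\<close>.\<close>
  obtain N where N: "inverse (real n) ^ N < \<epsilon>"
    using real_arch_pow_inv[OF \<epsilon>(1), of "inverse (real n)"] n_ge(3) by (auto simp: inverse_less_1_iff)
  have small: "\<bar>y / real n ^ N\<bar> < \<epsilon>" if "0 \<le> y" "y \<le> 1 / 2" for y
  proof -
    have "\<bar>y / real n ^ N\<bar> \<le> 1 / real n ^ N"
      using that n_ge(2) by (simp add: divide_right_mono)
    then show ?thesis using N by (simp add: power_inverse divide_inverse)
  qed
  have V: "y / real n ^ N \<in> T" if "y \<in> E (shift N b)" for y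
  proof -
    obtain f where f: "f \<in> box (shift N b)" "y = val f" using \<open>y \<in> _\<close> by (auto simp: E_def)
    have "(\<lambda>_. 0) \<in> box b" using b by (simp add: box_def)
    moreover have "pre N (\<lambda>_. 0) = 0" by (induction N) auto
    ultimately have "y / real n ^ N \<in> E b" using glue[OF bd _ f(1), of "\<lambda>_. 0"] f(2) by simp
    then show ?thesis
      using near[OF T(2)] small E_bounds[OF shift_digits[OF bd] that] by (simp add: abs_minus_commute)
  qed
  obtain m where m: "m \<in> T" "\<And>y. y \<in> T \<Longrightarrow> y \<le> m"
    using compact_attains_sup[OF T'(1)] T(2) by blast
  obtain e where e: "e \<in> box b" "m = val e" using m(1) TE by (auto simp: E_def)
  \<comment> \<open>Making all digits of \<open>m\<close> from index \<open>N\<close> on maximal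
    stays in the cylinder of \<open>m\<close>, hence in \<open>T\<close>. By maximality of
    \<open>m\<close> the value is unchanged, so \<open>m\<close> is the right end of its
    cylinder.\<close>
  define e' where "e' k = (if k < N then e k else b k)" for k
  have e': "e' \<in> box b" using e b by (auto simp: e'_def box_def)
  have pre_e': "pre N e' = pre N e" by (rule pre_cong) (simp add: e'_def)
  have shift_e': "shift N e' = shift N b" by (rule ext) (simp add: e'_def shift_def)
  have val_e': "val e' = (val (shift N b) + of_int (pre N e)) / real n ^ N"
    using val_pre[OF box_digits[OF bd e'], of N] pre_e' shift_e' n_ge(2) by (simp add: field_simps)
  have "m = (val (shift N e) + of_int (pre N e)) / real n ^ N"
    using val_pre[OF box_digits[OF bd e(1)], of N] e(2) n_ge(2) by (simp add: field_simps)
  then have "val e' - m = (val (shift N b) - val (shift N e)) / real n ^ N"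
    unfolding val_e' by (simp add: diff_divide_distrib[symmetric])
  moreover have "0 \<le> val (shift N b) - val (shift N e)"
    using val_le[OF shift_digits[OF box_digits[OF bd e(1)]] shift_digits[OF bd], of N N] e(1)
    by (simp add: box_def shift_def)
  moreover have "val (shift N b) - val (shift N e) \<le> 1 / 2"
    using val_half[OF shift_digits[OF bd], of N]
      val_nonneg[OF shift_digits[OF bd] shift_box[OF e(1)], of N] by linarith
  ultimately have "0 \<le> val e' - m" "\<bar>val e' - m\<bar> < \<epsilon>"
    using small by simp_all
  then have d: "\<bar>m - val e'\<bar> < \<epsilon>" "m \<le> val e'" by linarith+
  have "val e' \<in> E b" using e' by (simp add: E_def)
  then have m_eq: "m = val e'" using near[OF m(1) _ d(1)] m(2) d(2) by (meson antisym)
  have W: "m - y / real n ^ N \<in> T" if "y \<in> E (shift N b)" for y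
  proof -
    obtain f where f: "f \<in> box (shift N b)" "y = val f" using \<open>y \<in> _\<close> by (auto simp: E_def)
    have fd: "f \<in> digits" using f(1) box_digits shift_digits bd by blast
    \<comment> \<open>Complementary digits turn the distance \<open>y\<close> from the left end of a
      tail set into the distance \<open>y\<close> from its right end.\<close>
    define g where "g k = shift N b k - f k" for k
    have "g \<in> box (shift N b)" using f(1) by (simp add: box_def g_def)
    then have "(val g + of_int (pre N e)) / real n ^ N \<in> E b" by (rule glue[OF bd e(1)])
    moreover have "val g = val (shift N b) - y"
      unfolding g_def f(2) by (rule val_diff[OF shift_digits[OF bd] fd])
    ultimately have "m - y / real n ^ N \<in> E b"
      unfolding m_eq val_e' by (simp add: diff_divide_distrib add_divide_distrib algebra_simps)
    then show ?thesis
      using near[OF m(1)] small E_bounds[OF shift_digits[OF bd] that] by simp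
  qed
  obtain i t where i: "i \<in> {1..l}" "t \<in> T" "r i * t + c i = 0" using T(2) T'(3) by force
  have maps: "r i * y + c i \<in> T" if "y \<in> T" for y using that i(1) T'(3) by blast
  have nonneg: "0 \<le> y" if "y \<in> T" for y using that TE E_bounds[OF bd] by blast
  have "\<bar>r i\<bar> * (y / real n ^ N) \<in> T" if y: "y \<in> E (shift N b)" for y
  proof (cases "r i > 0")
    case True
    have "0 \<le> c i" using nonneg[OF maps[OF T(2)]] by simp
    moreover have "0 \<le> r i * t" using True nonneg[OF i(2)] by simp
    ultimately have "c i = 0" using i(3) by linarith
    then show ?thesis using maps[OF V[OF y]] True by simp
  next
    case False
    have "0 \<le> r i * m + c i" using nonneg[OF maps[OF m(1)]] .
    moreover have "r i * m \<le> r i * t" using False m(2)[OF i(2)] by (intro mult_left_mono_neg) auto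
    ultimately have "r i * m + c i = 0" using i(3) by linarith
    moreover have "r i * (m - y / real n ^ N) + c i = (r i * m + c i) + \<bar>r i\<bar> * (y / real n ^ N)"
      using False by (simp add: algebra_simps)
    ultimately show ?thesis using maps[OF W[OF y]] by simp
  qed
  then have scaled: "(\<bar>r i\<bar> * y) / real n ^ N \<in> E b" if "y \<in> E (shift N b)" for y
    using that TE by auto
  have ri: "0 < \<bar>r i\<bar>" "\<bar>r i\<bar> < 1" using T'(2) i(1) by auto
  have "\<bar>r i\<bar> * y \<in> E (shift N b)" if y: "y \<in> E (shift N b)" for y
  proof (rule small_in_E[OF bd scaled[OF y]])
    have "\<bar>r i\<bar> * y \<le> 1 * (1 / 2)"
      using E_bounds[OF shift_digits[OF bd] y] ri by (intro mult_mono) auto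
    then show "\<bar>r i\<bar> * y < 1" by simp
  qed
  then show ?thesis using that ri by blast
qed

section \<open>Rational translations with prescribed absolute digits\<close>

text \<open>The section depends only on \<open>\<bar>a\<^sub>k\<bar>\<close>, so the signs are free; alternating ones exclude the tails
  \<open>M, M, \<dots>\<close> and \<open>-M, -M, \<dots>\<close> of the points with two expansions.\<close>

lemma not_half_adic_alternating:
  assumes c: "c \<in> digits" and alt: "\<And>k. c k * c (Suc k) \<le> 0"
  shows "\<not> half_adic (val c)"
proof
  assume "half_adic (val c)"
  then obtain K i where "val c * real n ^ K = of_int i + 1 / 2" by (auto simp: half_adic_def)
  then have v: "val (shift K c) = of_int (i - pre K c) + 1 / 2" using val_pre[OF c, of K] by simp
  have sd: "shift K c \<in> digits" using c by blast
  have pos: "int M * int M > 0" using M_pos by simp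
  have "i - pre K c = 0 \<or> i - pre K c = -1" using val_half[OF sd] unfolding v by linarith
  then have "val (shift K c) = 1 / 2 \<or> val (\<lambda>k. - shift K c k) = 1 / 2"
    unfolding val_uminus[OF sd] v by auto
  then have "(\<forall>k. shift K c k = int M) \<or> (\<forall>k. - shift K c k = int M)"
    using val_eq_half[OF sd] val_eq_half[OF uminus_digits[OF sd]] by blast
  then have "c K * c (Suc K) = int M * int M"
    unfolding shift_def by (metis add_0 add_Suc minus_mult_minus)
  then show False using alt[of K] pos by linarith
qed

text \<open>Giving the digits \<open>\<bar>a k\<bar>\<close> alternating signs keeps them eventually
  periodic and avoids the half-adic case. The global sign \<sigma> stays free in order to make the
  value nonnegative, as a translation in \<open>[0, 1]\<close> is wanted.\<close>

lemma ex_rational_alternating: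
  assumes a: "a \<in> digits" and p: "p \<ge> 1"
    "shift p (shift K (\<lambda>k. int M - \<bar>a k\<bar>)) = shift K (\<lambda>k. int M - \<bar>a k\<bar>)"
  obtains c where "c \<in> digits" "\<And>k. \<bar>c k\<bar> = \<bar>a k\<bar>" "val c \<in> \<rat>" "\<not> half_adic (val c)" "0 \<le> val c"
proof -
  define c where "c \<sigma> k = \<sigma> * (-1) ^ k * \<bar>a k\<bar>" for \<sigma> :: int and k
  have abs: "\<bar>c \<sigma> k\<bar> = \<bar>a k\<bar>" if "\<bar>\<sigma>\<bar> = 1" for \<sigma> k
    using that by (simp add: c_def abs_mult power_abs)
  have cd: "c \<sigma> \<in> digits" if "\<bar>\<sigma>\<bar> = 1" for \<sigma>
    using a abs[OF that] by (simp add: digits_def)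
  have per: "\<bar>a (k + p + K)\<bar> = \<bar>a (k + K)\<bar>" for k
    using fun_cong[OF p(2), of k] by (simp add: shift_def)
  \<comment> \<open>The period is doubled because \<open>(-1) ^ k\<close> has period 2.\<close>
  have "\<bar>a (k + 2 * p + K)\<bar> = \<bar>a (k + K)\<bar>" for k
    using per[of "k + p"] per[of k] by (simp only: mult_2 add.assoc)
  then have "shift (2 * p) (shift K (c \<sigma>)) = shift K (c \<sigma>)" for \<sigma>
    by (intro ext) (simp add: shift_def c_def power_add power_mult)
  then have rat: "val (c \<sigma>) \<in> \<rat>" if "\<bar>\<sigma>\<bar> = 1" for \<sigma>
    using rational_val[OF cd[OF that], of "2 * p" K] p(1) by simp
  have "c \<sigma> k * c \<sigma> (Suc k) \<le> 0" if "\<bar>\<sigma>\<bar> = 1" for \<sigma> k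
  proof -
    have "c \<sigma> k * c \<sigma> (Suc k) = - ((\<sigma> * (-1) ^ k)\<^sup>2 * (\<bar>a k\<bar> * \<bar>a (Suc k)\<bar>))"
      by (simp add: c_def power2_eq_square algebra_simps)
    then show ?thesis by simp
  qed
  then have nh: "\<not> half_adic (val (c \<sigma>))" if "\<bar>\<sigma>\<bar> = 1" for \<sigma>
    using not_half_adic_alternating[OF cd] that by blast
  have "c (-1) = (\<lambda>k. - c 1 k)" by (simp add: c_def fun_eq_iff)
  then have "val (c (-1)) = - val (c 1)" using val_uminus[OF cd[of 1]] by simp
  then obtain \<sigma> where "\<bar>\<sigma>\<bar> = 1" "0 \<le> val (c \<sigma>)"
    by (metis abs_minus_cancel abs_one linear neg_0_le_iff_le)
  then show ?thesis using that[of "c \<sigma>"] cd abs rat nh by blast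
qed

section \<open>Transfer from \<open>C\<close> to the Cantor set and its sections\<close>

lemma cantor_set_eq:
  assumes D: "D = (\<lambda>i. i * d) ` {0..M}" and d: "d > 0"
  shows "cantor_set n D = (\<lambda>y. real d * y) ` C"
proof -
  have scale: "(\<Sum>k. real (x (Suc k)) / real n ^ Suc k) = real d * val e"
    if "\<And>k. real (x (Suc k)) = real d * of_int (e k)" "e \<in> digits" for x e
  proof -
    have "(\<Sum>k. real (x (Suc k)) / real n ^ Suc k) = (\<Sum>k. real d * (of_int (e k) / real n ^ Suc k))"
      by (simp add: that(1))
    also have "\<dots> = real d * val e"
      unfolding val_def by (rule suminf_mult[OF summable_digits[OF that(2)]])
    finally show ?thesis .
  qed
  show ?thesis
  proof (intro set_eqI iffI)
    fix y assume "y \<in> cantor_set n D"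
    then obtain x where x: "\<forall>k\<ge>1. x k \<in> D" "y = (\<Sum>k. real (x (Suc k)) / real n ^ Suc k)"
      unfolding cantor_set_def by blast
    have "\<exists>i. i \<le> M \<and> x (Suc k) = i * d" for k using x(1) unfolding D by force
    then obtain e where e: "\<And>k. e k \<le> M" "\<And>k. x (Suc k) = e k * d" by metis
    have box: "(\<lambda>k. int (e k)) \<in> box (\<lambda>k. int M)" using e(1) by (simp add: box_def)
    have "y = real d * val (\<lambda>k. int (e k))"
      unfolding x(2) by (rule scale[OF _ box_const_digits[OF box]]) (simp add: e(2))
    then show "y \<in> (\<lambda>y. real d * y) ` C" using box unfolding E_def by blast
  next
    fix y assume "y \<in> (\<lambda>y. real d * y) ` C"
    then obtain e where e: "e \<in> box (\<lambda>k. int M)" "y = real d * val e" by (auto simp: E_def)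
    \<comment> \<open>The digits in \<open>cantor_set\<close> are indexed from 1, those of
      \<open>e\<close> from 0. At 0 truncated subtraction yields \<open>nat (e 0) * d\<close>, which
      the sum does not read.\<close>
    define x where "x k = nat (e (k - 1)) * d" for k
    have "nat (e (k - 1)) \<le> M" for k using e(1) by (simp add: box_def nat_le_iff)
    then have "x k \<in> D" for k unfolding D x_def by (intro imageI) simp
    moreover have "y = (\<Sum>k. real (x (Suc k)) / real n ^ Suc k)"
      unfolding e(2) using e(1)
      by (intro scale[symmetric] box_const_digits) (auto simp: x_def box_def)
    ultimately show "y \<in> cantor_set n D" unfolding cantor_set_def by blast
  qed
qed

context
  fixes D :: "nat set" and d :: nat
  assumes cantor: "cantor_set n D = (\<lambda>y. real d * y) ` C" and d_pos: "d > 0"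
begin

lemma cantor_inter_eq: "cantor_inter n D x = (\<lambda>y. real d * y) ` (C \<inter> (\<lambda>y. y + x / real d) ` C)"
proof -
  have inj: "inj (\<lambda>y. real d * y)" using d_pos by (simp add: inj_def)
  have "(\<lambda>y. y + x) ` (\<lambda>y. real d * y) ` C = (\<lambda>y. real d * y) ` (\<lambda>y. y + x / real d) ` C"
    unfolding image_image using d_pos by (intro image_cong) (auto simp: field_simps)
  then show ?thesis unfolding cantor_inter_def cantor by (simp only: image_Int[OF inj])
qed

lemma cantor_section_finite: "half_adic (x / real d) \<Longrightarrow> finite (cantor_section n D x)"
  unfolding cantor_section_def cantor_inter_eq by (simp add: finite_inter_if_half_adic)

text \<open>The minimum of \<open>E b\<close> is 0, so the normalisation removes exactly the offset
  \<open>w\<close>, and with it all dependence on the signs of \<open>a\<close>.\<close>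

lemma cantor_section_eq:
  assumes a: "a \<in> digits" "x / real d = val a" and nh: "\<not> half_adic (val a)"
  shows "cantor_section n D x = (\<lambda>y. real d * y) ` E (\<lambda>k. int M - \<bar>a k\<bar>)"
proof -
  let ?b = "\<lambda>k. int M - \<bar>a k\<bar>"
  define w where "w = real d * val (\<lambda>k. max 0 (a k))"
  have b: "?b \<in> box (\<lambda>k. int M)" using a(1) by (simp add: box_def digits_def)
  have inter: "cantor_inter n D x = (\<lambda>y. real d * y + w) ` E ?b"
    unfolding cantor_inter_eq a(2) C_inter_translate[OF a(1) nh] w_def image_image
    by (simp add: distrib_left)
  have "Inf (cantor_inter n D x) = w"
  proof (rule cInf_eq_minimum)
    show "w \<in> cantor_inter n D x" unfolding inter using zero_in_E[OF b] by force
    show "w \<le> y" if "y \<in> cantor_inter n D x" for y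
      using that E_bounds[OF box_const_digits[OF b]] unfolding inter by auto
  qed
  moreover have "cantor_inter n D x \<noteq> {}" unfolding inter using zero_in_E[OF b] by blast
  ultimately show ?thesis
    unfolding cantor_section_def by (simp add: inter image_image)
qed

text \<open>In the half-adic case only finitely many points remain, each a self-similar singleton.
  Otherwise the digits of a rational translation are eventually periodic, and so are the bounds
  \<open>M - \<bar>a k\<bar>\<close>.\<close>

lemma finite_disjoint_union_if_rational:
  assumes "t \<in> \<rat>" "cantor_inter n D t \<noteq> {}"
  shows "finite_disjoint_union_self_similar (cantor_section n D t)"
proof (cases "half_adic (t / real d)")
  case True
  then show ?thesis
    using cantor_section_finite finite_disjoint_union_self_similar_finite by blast
next
  case False
  obtain a where a: "a \<in> digits" "t / real d = val a"
    using assms(2) unfolding cantor_inter_eq by (auto intro: C_inter_nonempty[of "t / real d"])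
  have "val a \<in> \<rat>" unfolding a(2)[symmetric] using assms(1) by simp
  then obtain p K where p: "p \<ge> 1" "shift p (shift K a) = shift K a"
    using eventually_periodic_if_rational[OF a(1)] False unfolding a(2) by blast
  let ?b = "\<lambda>k. int M - \<bar>a k\<bar>"
  have "shift p (shift K ?b) = shift K ?b"
    using p(2) by (simp add: shift_def fun_eq_iff)
  moreover have "?b \<in> box (\<lambda>k. int M)" using a(1) by (simp add: box_def digits_def)
  ultimately have "finite_disjoint_union_self_similar (E ?b)"
    using finite_disjoint_union_self_similar_E p(1) by blast
  from finite_disjoint_union_self_similar_affine[OF this, of "real d" 0] show ?thesis
    using cantor_section_eq[OF a] False d_pos unfolding a(2) by simp
qed

text \<open>In the half-adic case \<open>x\<close> is itself rational and serves as
  \<open>t\<close>. Otherwise a rational translation with the same absolute digits has the same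
  section; it is at most 1 because its value is bounded by \<open>d * M / (n - 1)\<close>.\<close>

lemma ex_rational_if_finite_disjoint_union:
  assumes dM: "d * M < n" and x: "x \<in> {0..1}" and inter: "cantor_inter n D x \<noteq> {}"
    and fdu: "finite_disjoint_union_self_similar (cantor_section n D x)"
  shows "\<exists>t\<in>\<rat> \<inter> {0..1}. cantor_section n D x = cantor_section n D t"
proof (cases "half_adic (x / real d)")
  case True
  then have "x / real d * real d \<in> \<rat>" using half_adic_rational by (intro Rats_mult) auto
  then have "x \<in> \<rat>" using d_pos by simp
  then show ?thesis using x by blast
next
  case False
  obtain a where a: "a \<in> digits" "x / real d = val a"
    using inter unfolding cantor_inter_eq by (auto intro: C_inter_nonempty[of "x / real d"])
  let ?b = "\<lambda>k. int M - \<bar>a k\<bar>"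
  have b: "?b \<in> box (\<lambda>k. int M)" using a(1) by (simp add: box_def digits_def)
  have section_eq: "cantor_section n D x = (\<lambda>y. real d * y) ` E ?b"
    using cantor_section_eq[OF a] False a(2) by simp
  have "finite_disjoint_union_self_similar ((\<lambda>y. 1 / real d * y + 0) ` cantor_section n D x)"
    using d_pos by (intro finite_disjoint_union_self_similar_affine fdu) simp
  then have "finite_disjoint_union_self_similar (E ?b)"
    unfolding section_eq image_image using d_pos by simp
  then obtain N \<rho> where \<rho>: "0 < \<rho>" "\<rho> < 1" "\<And>y. y \<in> E (shift N ?b) \<Longrightarrow> \<rho> * y \<in> E (shift N ?b)"
    using contraction_if_finite_disjoint_union_self_similar[OF b] by metis
  obtain p K where p: "p \<ge> 1" "shift p (shift K (shift N ?b)) = shift K (shift N ?b)"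
    using eventually_periodic_if_contracted[OF shift_const_box[OF b] \<rho>] by metis
  then obtain c where c: "c \<in> digits" "\<And>k. \<bar>c k\<bar> = \<bar>a k\<bar>" "val c \<in> \<rat>"
      "\<not> half_adic (val c)" "0 \<le> val c"
    using ex_rational_alternating[OF a(1) p(1), of "K + N"] by (auto simp: shift_shift)
  define t where "t = real d * val c"
  have td: "t / real d = val c" using d_pos by (simp add: t_def)
  have "t \<in> \<rat>" using c(3) by (simp add: t_def)
  moreover have "t \<le> 1"
  proof -
    have "real d * val c \<le> real d * (real M / (real n - 1))"
      using val_upper[OF c(1)] by (intro mult_left_mono) auto
    also have "\<dots> = real (d * M) / (real n - 1)" by simp
    also have "\<dots> \<le> 1"
    proof -
      have "real (d * M) \<le> real n - 1" using dM by linarith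
      then show ?thesis using n_ge(3) by (simp del: of_nat_mult)
    qed
    finally show ?thesis by (simp add: t_def)
  qed
  moreover have "cantor_section n D t = cantor_section n D x"
    using cantor_section_eq[OF c(1) td c(4)] c(2) section_eq by simp
  moreover have "0 \<le> t" using c(5) by (simp add: t_def)
  ultimately show ?thesis by (intro bexI[of _ t]) auto
qed

end

end

section \<open>Uniform digit sets and the equivalence\<close>

lemma uniform_digit_setE:
  assumes "digit_set n D" "uniform_digit_set D"
  obtains d M where "D = (\<lambda>i. i * d) ` {0..M}" "d \<ge> 2" "M \<ge> 1" "d * M \<le> n - 1"
proof -
  let ?xs = "sorted_list_of_set D"
  have D: "D \<subseteq> {0..n - 1}" "2 \<le> card D" "Min D = 0"
    using assms(1) by (auto simp: digit_set_def)
  have fin: "finite D" using D(1) finite_subset by blast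
  obtain d where d: "d \<ge> 2" "\<And>k. Suc k < card D \<Longrightarrow> ?xs ! Suc k = ?xs ! k + d"
    using assms(2) by (auto simp: uniform_digit_set_def)
  have "D \<noteq> {}" using D(2) by auto
  then have "?xs ! 0 = 0" using sorted_list_of_set_nonempty[OF fin] D(3) by simp
  then have nth: "?xs ! k = k * d" if "k < card D" for k
    using that d(2) by (induction k) auto
  have "D = set ?xs" using fin by simp
  also have "\<dots> = (\<lambda>k. ?xs ! k) ` {0..<card D}"
    using fin by (simp add: set_conv_nth image_def) (metis atLeastLessThan_iff zero_le)
  also have "\<dots> = (\<lambda>i. i * d) ` {0..<card D}" using nth by (intro image_cong) auto
  also have "{0..<card D} = {0..card D - 1}" using D(2) by auto
  finally have D_eq: "D = (\<lambda>i. i * d) ` {0..card D - 1}" .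
  then have "(card D - 1) * d \<in> D" by (metis atLeastAtMost_iff imageI order_refl zero_le)
  then have "d * (card D - 1) \<le> n - 1" using D(1) by (auto simp: mult.commute)
  then show ?thesis using that[OF D_eq d(1)] D(2) by simp
qed

theorem theorem1p4:
  fixes n :: nat and D :: "nat set" and x :: real
  assumes "n \<ge> 3"
    and "digit_set n D"
    and "uniform_digit_set D"
    and "x \<in> {0..1}"
    and "cantor_set n D \<inter> (\<lambda>y. y + x) ` cantor_set n D \<noteq> {}"
  shows "(\<exists>t\<in>\<rat> \<inter> {0..1}. cantor_section n D x = cantor_section n D t) \<longleftrightarrow>
         finite_disjoint_union_self_similar (cantor_section n D x)"
proof -
  obtain d M where D: "D = (\<lambda>i. i * d) ` {0..M}" and d: "d \<ge> 2" "M \<ge> 1" "d * M \<le> n - 1"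
    using uniform_digit_setE[OF assms(2,3)] .
  have dM: "d * M < n" using d(3) assms(1) by linarith
  \<comment> \<open>The gap \<open>d \<ge> 2\<close> is what provides
    \<open>2 * M < n\<close>.\<close>
  have "2 * M \<le> d * M" using d(1) by (rule mult_le_mono1)
  then interpret digit_expansion n M using d(2) dM by unfold_locales linarith+
  have d_pos: "d > 0" using d(1) by simp
  note cantor = cantor_set_eq[OF D d_pos]
  have inter: "cantor_inter n D x \<noteq> {}" using assms(5) by (simp add: cantor_inter_def)
  show ?thesis
  proof
    assume "\<exists>t\<in>\<rat> \<inter> {0..1}. cantor_section n D x = cantor_section n D t"
    then obtain t where t: "t \<in> \<rat>" "cantor_section n D x = cantor_section n D t" by blast
    \<comment> \<open>A section is empty exactly when the intersection is, so nonemptiness passes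
      from \<open>x\<close> to \<open>t\<close>.\<close>
    have "cantor_inter n D t \<noteq> {}"
      using inter t(2) by (auto simp: cantor_section_def split: if_splits)
    then show "finite_disjoint_union_self_similar (cantor_section n D x)"
      unfolding t(2) by (rule finite_disjoint_union_if_rational[OF cantor d_pos t(1)])
  next
    assume "finite_disjoint_union_self_similar (cantor_section n D x)"
    then show "\<exists>t\<in>\<rat> \<inter> {0..1}. cantor_section n D x = cantor_section n D t"
      by (rule ex_rational_if_finite_disjoint_union[OF cantor d_pos dM assms(4) inter])
  qed
qed

end
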